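(* Let $T>0$ and $k,n_1,n_2\in\mathbb{N}$. If $\rho(x):=\max(x,0)$ is the ReLU activation function, then the set $\mathcal{NN}^{\rho}_{k+1;n_1,n_2}$ of deep neural networks (with input $(t,x)\in\mathbb{R}^{k+1}$, regarded as functions on $[0,T]\times\mathbb{R}^k$ by restriction) has the universal approximation property under a linear growth constraint. Moreover, the constant $\widetilde{C}_f$ in the definition of this property can be chosen to be $\widetilde{C}_f=\sqrt{n_1n_2}\,(1+C_f)$.
   Context: The spaces $\mathbb{R}^k$ and $\mathbb{R}^{n_1\times n_2}$ carry the Euclidean norm $|\cdot|$ (for matrices, the Euclidean norm of the entries). For a set $K$ and a function $f$, $\|f\|_{\infty,K}:=\sup_{x\in K}|f(x)|$. Universal approximation property under a linear growth constraint: a set $\mathcal{N}\subset C([0,T]\times\mathbb{R}^k;\mathbb{R}^{n_1\times n_2})$ has this property if for every $f\in C([0,T]\times\mathbb{R}^k;\mathbb{R}^{n_1\times n_2})$ for which there is a constant $C_f>0$ with $|f(t,x)|\le C_f(1+|x|)$ for all $t\in[0,T]$, $x\in\mathbb{R}^k$, there exists a constant $\widetilde{C}_f>0$ such that for every $\epsilon\in(0,1)$ and every compact set $K\subset\mathbb{R}^k$ there exists $\varphi\in\mathcal{N}$ with $\|\varphi-f\|_{\infty,[0,T]\times K}\le\epsilon$ and $|\varphi(t,x)|\le\widetilde{C}_f(1+|x|)$ for all $t\in[0,T]$, $x\in\mathbb{R}^k$ (so $\widetilde{C}_f$ does not depend on $\epsilon$ and $K$). Deep networks: given $L,N_0,\dots,N_L\in\mathbb{N}$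 and affine maps $w_l:\mathbb{R}^{N_{l-1}}\to\mathbb{R}^{N_l}$, $w_l(x)=A_lx+b_l$ ($l=1,\dots,L$), a deep feed-forward neural network with activation function $\rho$ is $\varphi=w_L\circ\rho\circ w_{L-1}\circ\dots\circ\rho\circ w_1:\mathbb{R}^{N_0}\to\mathbb{R}^{N_L}$, with $\rho$ applied componentwise. $\mathcal{NN}^{\rho}_{N_0;N_L}$ denotes the set of all such networks with input dimension $N_0$, output dimension $N_L$, and arbitrary number of layers $L$ and hidden widths $N_1,\dots,N_{L-1}$. $\mathcal{NN}^{\rho}_{n_0;n_1,n_2}$ denotes the set of functions $\varphi=(\varphi^{ij})_{i=1,\dots,n_1,\,j=1,\dots,n_2}:\mathbb{R}^{n_0}\to\mathbb{R}^{n_1\times n_2}$ with every $\varphi^{ij}\in\mathcal{NN}^{\rho}_{n_0;1}$. *)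

theory Defs
  imports "HOL-Analysis.Analysis" "Jordan_Normal_Form.Matrix"
begin

(* Layer widths vary inside the definition of a network, so network vectors and
   matrices are those of Jordan_Normal_Form (with explicit carriers).  The fixed
   spaces R^k and R^(n1 x n2) are real ^ 'k and real ^ 'n2 ^ 'n1; on the latter the
   library norm is the Euclidean norm of the entries.  From here on $ is the
   component of a real ^ 'n. *)
no_notation vec_index (infixl "$" 100)

definition relu :: "real \<Rightarrow> real" where
  "relu x = max x 0"

(* Layers are numbered 1, ..., L; the value at L = 0 is never used. *)
fun feed_forward :: "(real \<Rightarrow> real) \<Rightarrow> (nat \<Rightarrow> real vec \<Rightarrow> real vec) \<Rightarrow> nat \<Rightarrow> real vec \<Rightarrow> real vec" where
  "feed_forward \<rho> w 0 = id"
| "feed_forward \<rho> w (Suc 0) = w 1"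
| "feed_forward \<rho> w (Suc (Suc l)) = w (Suc (Suc l)) \<circ> map_vec \<rho> \<circ> feed_forward \<rho> w (Suc l)"

(* Membership depends only on the values of \<phi> on carrier_vec n, i.e. on R^n. *)
definition deep_nn :: "(real \<Rightarrow> real) \<Rightarrow> nat \<Rightarrow> nat \<Rightarrow> (real vec \<Rightarrow> real vec) set" where
  "deep_nn \<rho> n m = {\<phi>. \<exists>L (N :: nat \<Rightarrow> nat) A b.
     1 \<le> L \<and> N 0 = n \<and> N L = m \<and> (\<forall>l\<le>L. 1 \<le> N l) \<and>
     (\<forall>l\<in>{1..L}. A l \<in> carrier_mat (N l) (N (l - 1)) \<and> b l \<in> carrier_vec (N l)) \<and>
     (\<forall>x\<in>carrier_vec n. \<phi> x = feed_forward \<rho> (\<lambda>l y. A l *\<^sub>v y + b l) L x)}"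

(* Each scalar entry is viewed as a vector of dimension 1. *)
definition deep_nn_mat :: "(real \<Rightarrow> real) \<Rightarrow> nat \<Rightarrow> (real vec \<Rightarrow> real ^ 'n2 ^ 'n1) set" where
  "deep_nn_mat \<rho> n = {\<phi>. \<forall>i j. (\<lambda>v. Matrix.vec 1 (\<lambda>_. \<phi> v $ i $ j)) \<in> deep_nn \<rho> n 1}"

(* The point (t, x) as an element of R^(k+1).  The coordinates of x are listed along
   the bijection from_nat_into UNIV from {..<CARD('k)} to 'k; a different enumeration
   only permutes the columns of the first weight matrix. *)
definition input_vec :: "real \<times> (real ^ 'k) \<Rightarrow> real vec" where
  "input_vec = (\<lambda>(t, x). vCons t (Matrix.vec CARD('k) (\<lambda>i. x $ from_nat_into UNIV i)))"

definition deep_nn_time_space :: "(real \<Rightarrow> real) \<Rightarrow> (real \<times> (real ^ 'k) \<Rightarrow> real ^ 'n2 ^ 'n1) set" where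
  "deep_nn_time_space \<rho> = {\<phi> \<circ> input_vec | \<phi>. \<phi> \<in> deep_nn_mat \<rho> (CARD('k) + 1)}"

(* Extended-valued, so that it is 0 on the empty set and \<infinity> for unbounded f. *)
definition sup_norm :: "'a set \<Rightarrow> ('a \<Rightarrow> 'b::real_normed_vector) \<Rightarrow> ennreal" where
  "sup_norm K f = (SUP z\<in>K. ennreal (norm (f z)))"

definition linear_growth :: "real \<Rightarrow> real \<Rightarrow> (real \<times> (real ^ 'k) \<Rightarrow> 'b::real_normed_vector) \<Rightarrow> bool" where
  "linear_growth T C f \<longleftrightarrow> (\<forall>t\<in>{0..T}. \<forall>x. norm (f (t, x)) \<le> C * (1 + norm x))"

definition approximable_with_growth ::
    "real \<Rightarrow> (real \<times> (real ^ 'k) \<Rightarrow> 'b::real_normed_vector) set \<Rightarrow> (real \<times> (real ^ 'k) \<Rightarrow> 'b) \<Rightarrow> real \<Rightarrow> bool" where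
  "approximable_with_growth T \<N> f C \<longleftrightarrow>
     (\<forall>\<epsilon>\<in>{0<..<1}. \<forall>K. compact K \<longrightarrow>
        (\<exists>\<phi>\<in>\<N>. sup_norm ({0..T} \<times> K) (\<lambda>z. \<phi> z - f z) \<le> ennreal \<epsilon> \<and> linear_growth T C \<phi>))"

(* Elements of C([0,T] x R^k) are total functions, of which only the values on
   {0..T} \<times> UNIV play a role. *)
definition universal_approximation_linear_growth ::
    "real \<Rightarrow> (real \<times> (real ^ 'k) \<Rightarrow> 'b::real_normed_vector) set \<Rightarrow> bool" where
  "universal_approximation_linear_growth T \<N> \<longleftrightarrow>
     (\<forall>\<phi>\<in>\<N>. continuous_on ({0..T} \<times> UNIV) \<phi>) \<and>
     (\<forall>f. continuous_on ({0..T} \<times> UNIV) f \<and> (\<exists>C>0. linear_growth T C f) \<longrightarrow>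
        (\<exists>C'>0. approximable_with_growth T \<N> f C'))"

end

theory Submission
  imports Defs
begin

text \<open>The scalar functions computed by ReLU networks of arbitrary depth form a vector lattice that
  contains the affine functions, since \<open>max a b = a + relu (b - a)\<close>. By the Kakutani--Stone theorem they
  approximate every continuous function uniformly on compact sets. To enforce the growth bound, an
  approximation \<open>h\<close> is clipped to \<open>[-u, u]\<close>, where \<open>u\<close> is \<open>1 + C\<close> times a finite maximum of affine
  functions below \<open>1 + norm x\<close>, so fine that \<open>u\<close> dominates \<open>C * (1 + norm x)\<close> on the given compact set.\<close>

section \<open>ReLU networks form a vector lattice\<close>

text \<open>Generators enter one at a time, so closure properties are inductions over the
  derivation, with no bookkeeping of finite index sets.\<close>

inductive_set affine_span :: "('a \<Rightarrow> real) set \<Rightarrow> ('a \<Rightarrow> real) set" for B where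
  const: "(\<lambda>_. c) \<in> affine_span B"
| add: "g \<in> B \<Longrightarrow> h \<in> affine_span B \<Longrightarrow> (\<lambda>x. a * g x + h x) \<in> affine_span B"

lemma affine_span_base: "g \<in> B \<Longrightarrow> g \<in> affine_span B"
  using affine_span.add[OF _ affine_span.const[of 0], of g B 1] by simp

lemma affine_span_plus:
  assumes "h \<in> affine_span B" "k \<in> affine_span B"
  shows "(\<lambda>x. h x + k x) \<in> affine_span B"
  using assms(1)
proof induction
  case (const c)
  show ?case
    using assms(2)
  proof induction
    case (const d)
    show ?case by (rule affine_span.const)
  next
    case (add g h a)
    then show ?case
      using affine_span.add[of g B "\<lambda>x. c + h x" a] by (simp add: algebra_simps)
  qed
next
  case (add g h a)
  then show ?case
    using affine_span.add[of g B "\<lambda>x. h x + k x" a] by (simp add: algebra_simps)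
qed

lemma affine_span_scale:
  assumes "h \<in> affine_span B"
  shows "(\<lambda>x. r * h x) \<in> affine_span B"
  using assms
proof induction
  case (const c)
  show ?case by (rule affine_span.const)
next
  case (add g h a)
  then show ?case
    using affine_span.add[of g B "\<lambda>x. r * h x" "r * a"] by (simp add: algebra_simps)
qed

lemma affine_span_diff:
  assumes "h \<in> affine_span B" "k \<in> affine_span B"
  shows "(\<lambda>x. h x - k x) \<in> affine_span B"
  using affine_span_plus[OF assms(1) affine_span_scale[OF assms(2), of "-1"]] by simp

lemma affine_span_sum:
  assumes "finite I" "\<And>i. i \<in> I \<Longrightarrow> h i \<in> affine_span B"
  shows "(\<lambda>x. \<Sum>i\<in>I. h i x) \<in> affine_span B"
  using assms by (induction I rule: finite_induct) (auto intro: affine_span.const affine_span_plus)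

lemma affine_span_mono: "h \<in> affine_span B \<Longrightarrow> B \<subseteq> B' \<Longrightarrow> h \<in> affine_span B'"
  by (induction rule: affine_span.induct) (auto intro: affine_span.intros)

text \<open>A derivation mentions only finitely many generators. This is what keeps the width of a
  hidden layer finite.\<close>

lemma affine_span_finite:
  assumes "h \<in> affine_span B"
  shows "\<exists>G. finite G \<and> G \<subseteq> B \<and> h \<in> affine_span G"
  using assms
proof induction
  case (const c)
  show ?case by (intro exI[of _ "{}"]) (auto intro: affine_span.const)
next
  case (add g h a)
  then obtain G where "finite G" "G \<subseteq> B" "h \<in> affine_span G"
    by auto
  with add.hyps show ?case
    by (intro exI[of _ "insert g G"]) (auto intro!: affine_span.add intro: affine_span_mono)
qed

text \<open>The coefficients over an enumeration of the generators become a row of a weight matrix,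
  and \<open>c\<close> an entry of the bias.\<close>

lemma affine_span_list:
  assumes "h \<in> affine_span (set gs)"
  shows "\<exists>a c. \<forall>x. h x = (\<Sum>j<length gs. a j * (gs ! j) x) + c"
  using assms
proof induction
  case (const c)
  show ?case by (intro exI[of _ "\<lambda>_. 0"]) simp
next
  case (add g h s)
  then obtain a c where h: "\<And>x. h x = (\<Sum>j<length gs. a j * (gs ! j) x) + c"
    by auto
  obtain i where i: "i < length gs" "gs ! i = g"
    using add.hyps by (auto simp: in_set_conv_nth)
  \<comment> \<open>The list may contain \<open>g\<close> several times; \<open>s\<close> is added
    at the one position \<open>i\<close>.\<close>
  have "s * g x + h x = (\<Sum>j<length gs. (a j + (if j = i then s else 0)) * (gs ! j) x) + c" for x
    using i by (simp add: h distrib_right sum.distrib if_distrib[of "\<lambda>u. u * _"] cong: if_cong)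
  then show ?case
    by (intro exI[of _ "\<lambda>j. a j + (if j = i then s else 0)"] exI[of _ c]) simp
qed

text \<open>\<open>preact n l\<close> collects the scalar functions on \<open>R\<^sup>n\<close> that occur as a single output coordinate
  of a network with \<open>l\<close> hidden layers.\<close>
fun preact :: "nat \<Rightarrow> nat \<Rightarrow> (real vec \<Rightarrow> real) set" where
  "preact n 0 = affine_span ((\<lambda>i v. vec_index v i) ` {..<n})"
| "preact n (Suc l) = affine_span ((\<lambda>h v. relu (h v)) ` preact n l)"

lemma preact_const: "(\<lambda>_. c) \<in> preact n l"
  by (cases l) (auto intro: affine_span.const)

lemma preact_scale: "h \<in> preact n l \<Longrightarrow> (\<lambda>v. r * h v) \<in> preact n l"
  by (cases l) (auto intro: affine_span_scale)

lemma preact_diff: "h \<in> preact n l \<Longrightarrow> k \<in> preact n l \<Longrightarrow> (\<lambda>v. h v - k v) \<in> preact n l"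
  by (cases l) (auto intro: affine_span_diff)

lemma preact_plus: "h \<in> preact n l \<Longrightarrow> k \<in> preact n l \<Longrightarrow> (\<lambda>v. h v + k v) \<in> preact n l"
  by (cases l) (auto intro: affine_span_plus)

lemma preact_relu: "h \<in> preact n l \<Longrightarrow> (\<lambda>v. relu (h v)) \<in> preact n (Suc l)"
  by (auto intro: affine_span_base)

text \<open>The identity \<open>u = relu u - relu (- u)\<close> carries a value unchanged through
  one more hidden layer.\<close>

lemma preact_Suc:
  assumes "h \<in> preact n l"
  shows "h \<in> preact n (Suc l)"
proof -
  have "(\<lambda>v. relu (h v) - relu (- 1 * h v)) \<in> preact n (Suc l)"
    using assms by (intro preact_diff preact_relu preact_scale)
  moreover have "relu u - relu (- 1 * u) = u" for u
    by (simp add: relu_def)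
  ultimately show ?thesis by simp
qed

lemma preact_mono: "l \<le> l' \<Longrightarrow> h \<in> preact n l \<Longrightarrow> h \<in> preact n l'"
  by (induction rule: dec_induct) (auto intro: preact_Suc simp del: preact.simps)

definition relu_nets :: "nat \<Rightarrow> (real vec \<Rightarrow> real) set" where
  "relu_nets n = (\<Union>l. preact n l)"

text \<open>By \<open>preact_mono\<close> the shallower network can be deepened to the depth of the
  other, so that the two can be combined.\<close>

lemma relu_netsE2:
  assumes "h \<in> relu_nets n" "k \<in> relu_nets n"
  obtains l where "h \<in> preact n l" "k \<in> preact n l"
  using assms unfolding relu_nets_def by (meson UN_E max.cobounded1 max.cobounded2 preact_mono)

lemma relu_nets_scale: "h \<in> relu_nets n \<Longrightarrow> (\<lambda>v. r * h v) \<in> relu_nets n"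
  unfolding relu_nets_def using preact_scale by blast

lemma relu_nets_max:
  assumes "h \<in> relu_nets n" "k \<in> relu_nets n"
  shows "(\<lambda>v. max (h v) (k v)) \<in> relu_nets n"
proof -
  obtain l where l: "h \<in> preact n l" "k \<in> preact n l"
    using assms by (rule relu_netsE2)
  \<comment> \<open>The summand outside \<open>relu\<close> is lifted by \<open>preact_Suc\<close>
    to the depth of the other one.\<close>
  then have "(\<lambda>v. h v + relu (k v - h v)) \<in> preact n (Suc l)"
    by (intro preact_plus preact_relu preact_diff preact_Suc)
  moreover have "u + relu (w - u) = max u w" for u w
    by (simp add: relu_def)
  ultimately show ?thesis
    unfolding relu_nets_def by (metis (no_types, lifting) UNIV_I UN_I ext)
qed

lemma relu_nets_min:
  assumes "h \<in> relu_nets n" "k \<in> relu_nets n"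
  shows "(\<lambda>v. min (h v) (k v)) \<in> relu_nets n"
proof -
  have "(\<lambda>v. - 1 * max (- 1 * h v) (- 1 * k v)) \<in> relu_nets n"
    using assms by (intro relu_nets_scale relu_nets_max)
  moreover have "- 1 * max (- 1 * u) (- 1 * w) = min u w" for u w :: real
    by simp
  ultimately show ?thesis by simp
qed

lemma relu_nets_affine: "(\<lambda>v. c + (\<Sum>i<n. a i * vec_index v i)) \<in> relu_nets n"
proof -
  have "(\<lambda>v. \<Sum>i<n. a i * vec_index v i) \<in> preact n 0"
    unfolding preact.simps by (intro affine_span_sum affine_span_scale affine_span_base) auto
  then have "(\<lambda>v. c + (\<Sum>i<n. a i * vec_index v i)) \<in> preact n 0"
    by (intro preact_plus preact_const)
  then show ?thesis
    unfolding relu_nets_def by blast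
qed

section \<open>Realisation by feed-forward networks\<close>

lemma feed_forward_cong:
  assumes "\<And>l. 1 \<le> l \<Longrightarrow> l \<le> L \<Longrightarrow> w l = w' l"
  shows "feed_forward \<rho> w L = feed_forward \<rho> w' L"
  using assms by (induction \<rho> w L rule: feed_forward.induct) auto

text \<open>Row \<open>i\<close> of \<open>A\<close> and entry \<open>i\<close> of \<open>b\<close>
  hold the coefficients of \<open>hs ! i\<close> over \<open>gs\<close>, so one affine layer
  produces all of \<open>hs\<close> at once.\<close>

lemma affine_span_layer:
  assumes "set hs \<subseteq> affine_span (set gs)"
  obtains A b where "A \<in> carrier_mat (length hs) (length gs)" "b \<in> carrier_vec (length hs)"
    "\<And>x. A *\<^sub>v Matrix.vec (length gs) (\<lambda>i. (gs ! i) x) + b = Matrix.vec (length hs) (\<lambda>i. (hs ! i) x)"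
proof -
  have "\<exists>a c. \<forall>x. h x = (\<Sum>j<length gs. a j * (gs ! j) x) + c" if "h \<in> set hs" for h
    using affine_span_list assms that by blast
  then obtain a c where ac: "\<And>h x. h \<in> set hs \<Longrightarrow> h x = (\<Sum>j<length gs. a h j * (gs ! j) x) + c h"
    by metis
  let ?A = "Matrix.mat (length hs) (length gs) (\<lambda>(i, j). a (hs ! i) j)"
  let ?b = "Matrix.vec (length hs) (\<lambda>i. c (hs ! i))"
  have "?A *\<^sub>v Matrix.vec (length gs) (\<lambda>i. (gs ! i) x) + ?b = Matrix.vec (length hs) (\<lambda>i. (hs ! i) x)" for x
  proof (rule eq_vecI)
    fix i assume "i < dim_vec (Matrix.vec (length hs) (\<lambda>i. (hs ! i) x))"
    then have i: "i < length hs" by simp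
    show "vec_index (?A *\<^sub>v Matrix.vec (length gs) (\<lambda>i. (gs ! i) x) + ?b) i =
      vec_index (Matrix.vec (length hs) (\<lambda>i. (hs ! i) x)) i"
      using i ac[of "hs ! i" x] by (simp add: scalar_prod_def lessThan_atLeast0)
  qed simp
  then show thesis
    by (intro that[of ?A ?b]) auto
qed

text \<open>Whole lists are realised, because in the induction the previous network must output
  simultaneously all functions that feed the next layer. With \<open>l\<close> hidden layers there
  are \<open>Suc l\<close> affine maps.\<close>

lemma preact_realisation:
  assumes "1 \<le> n" "hs \<noteq> []" "set hs \<subseteq> preact n l"
  shows "\<exists>N A b. N 0 = n \<and> N (Suc l) = length hs \<and> (\<forall>j\<le>Suc l. 1 \<le> N j) \<and>
    (\<forall>j\<in>{1..Suc l}. A j \<in> carrier_mat (N j) (N (j - 1)) \<and> b j \<in> carrier_vec (N j)) \<and>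
    (\<forall>x\<in>carrier_vec n. feed_forward relu (\<lambda>j y. A j *\<^sub>v y + b j) (Suc l) x =
       Matrix.vec (length hs) (\<lambda>i. (hs ! i) x))"
  using assms(2,3)
proof (induction l arbitrary: hs)
  case 0
  let ?gs = "map (\<lambda>i (v :: real vec). vec_index v i) [0..<n]"
  have gs: "set ?gs = (\<lambda>i v. vec_index v i) ` {..<n}"
    by (auto simp: lessThan_atLeast0)
  have "set hs \<subseteq> affine_span (set ?gs)"
    using 0(2) unfolding gs by simp
  then obtain A b where A: "A \<in> carrier_mat (length hs) (length ?gs)" "b \<in> carrier_vec (length hs)"
    "\<And>x. A *\<^sub>v Matrix.vec (length ?gs) (\<lambda>i. (?gs ! i) x) + b = Matrix.vec (length hs) (\<lambda>i. (hs ! i) x)"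
    using affine_span_layer by blast
  \<comment> \<open>The vector of all coordinate projections at \<open>x\<close> is \<open>x\<close>
    itself, so the layer acts directly on the input.\<close>
  have "Matrix.vec (length ?gs) (\<lambda>i. (?gs ! i) x) = x" if "x \<in> carrier_vec n" for x
    using that by (intro eq_vecI) auto
  with A have "A *\<^sub>v x + b = Matrix.vec (length hs) (\<lambda>i. (hs ! i) x)" if "x \<in> carrier_vec n" for x
    using that by metis
  moreover have "1 \<le> length hs"
    using 0 by (simp add: Suc_le_eq)
  ultimately show ?case
    using A(1,2) assms(1)
    by (intro exI[of _ "\<lambda>j. if j = 0 then n else length hs"] exI[of _ "\<lambda>_. A"] exI[of _ "\<lambda>_. b"]) auto
next
  case (Suc l)
  let ?R = "\<lambda>h v. relu (h v)"
  have "\<forall>h\<in>set hs. \<exists>G. finite G \<and> G \<subseteq> ?R ` preact n l \<and> h \<in> affine_span G"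
    using Suc.prems(2) affine_span_finite by auto
  then obtain G where G: "\<And>h. h \<in> set hs \<Longrightarrow> finite (G h) \<and> G h \<subseteq> ?R ` preact n l \<and> h \<in> affine_span (G h)"
    by metis
  \<comment> \<open>The generators of all outputs are pooled and pulled back through
    \<open>relu\<close> to a finite set \<open>P\<close>, which the previous network has to
    output.\<close>
  have "finite (\<Union>h\<in>set hs. G h)" "(\<Union>h\<in>set hs. G h) \<subseteq> ?R ` preact n l"
    using G by auto
  then obtain P where P: "finite P" "P \<subseteq> preact n l" "(\<Union>h\<in>set hs. G h) = ?R ` P"
    using finite_subset_image by metis
  \<comment> \<open>The zero function is added because layer widths must be positive.\<close>
  obtain gs where gs: "set gs = insert (\<lambda>_. 0) P"
    using P(1) finite_list by blast
  have gs': "gs \<noteq> []" "set gs \<subseteq> preact n l"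
    using gs P(2) preact_const by force+
  obtain N A b where N: "N 0 = n" "N (Suc l) = length gs" "\<forall>j\<le>Suc l. 1 \<le> N j"
    "\<forall>j\<in>{1..Suc l}. A j \<in> carrier_mat (N j) (N (j - 1)) \<and> b j \<in> carrier_vec (N j)"
    "\<forall>x\<in>carrier_vec n. feed_forward relu (\<lambda>j y. A j *\<^sub>v y + b j) (Suc l) x =
       Matrix.vec (length gs) (\<lambda>i. (gs ! i) x)"
    using Suc.IH[OF gs'] by blast
  have "set hs \<subseteq> affine_span (set (map ?R gs))"
  proof
    fix h assume h: "h \<in> set hs"
    have "G h \<subseteq> set (map ?R gs)"
      using h P(3) gs by auto
    with G[OF h] show "h \<in> affine_span (set (map ?R gs))"
      by (blast intro: affine_span_mono)
  qed
  then obtain A' b' where A': "A' \<in> carrier_mat (length hs) (length gs)" "b' \<in> carrier_vec (length hs)"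
    "\<And>x. A' *\<^sub>v Matrix.vec (length gs) (\<lambda>i. (map ?R gs ! i) x) + b' = Matrix.vec (length hs) (\<lambda>i. (hs ! i) x)"
    using affine_span_layer[of hs "map ?R gs"] by auto
  let ?L = "Suc (Suc l)"
  let ?N = "N(?L := length hs)" and ?A = "A(?L := A')" and ?b = "b(?L := b')"
  have ff: "feed_forward relu (\<lambda>j y. ?A j *\<^sub>v y + ?b j) (Suc l) =
      feed_forward relu (\<lambda>j y. A j *\<^sub>v y + b j) (Suc l)"
    by (rule feed_forward_cong) auto
  have "feed_forward relu (\<lambda>j y. ?A j *\<^sub>v y + ?b j) ?L x = Matrix.vec (length hs) (\<lambda>i. (hs ! i) x)"
    if "x \<in> carrier_vec n" for x
  proof -
    have "map_vec relu (Matrix.vec (length gs) (\<lambda>i. (gs ! i) x)) =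
        Matrix.vec (length gs) (\<lambda>i. (map ?R gs ! i) x)"
      by (intro eq_vecI) auto
    then show ?thesis
      unfolding feed_forward.simps(3) comp_apply ff using N(5) that A'(3) by simp
  qed
  moreover have "\<forall>j\<le>?L. 1 \<le> ?N j"
    using N(3) Suc.prems(1) by (auto simp: Suc_le_eq le_Suc_eq)
  moreover have "\<forall>j\<in>{1..?L}. ?A j \<in> carrier_mat (?N j) (?N (j - 1)) \<and> ?b j \<in> carrier_vec (?N j)"
    using N(2,4) A'(1,2) by auto
  ultimately show ?case
    using N(1) by (intro exI[of _ ?N] exI[of _ ?A] exI[of _ ?b]) auto
qed

lemma relu_nets_deep_nn:
  assumes "1 \<le> n" "h \<in> relu_nets n"
  shows "(\<lambda>v. Matrix.vec 1 (\<lambda>_. h v)) \<in> deep_nn relu n 1"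
proof -
  obtain l where "h \<in> preact n l"
    using assms(2) unfolding relu_nets_def by blast
  then obtain N A b where N: "N 0 = n" "N (Suc l) = length [h]" "\<forall>j\<le>Suc l. 1 \<le> N j"
    "\<forall>j\<in>{1..Suc l}. A j \<in> carrier_mat (N j) (N (j - 1)) \<and> b j \<in> carrier_vec (N j)"
    "\<forall>x\<in>carrier_vec n. feed_forward relu (\<lambda>j y. A j *\<^sub>v y + b j) (Suc l) x =
       Matrix.vec (length [h]) (\<lambda>i. ([h] ! i) x)"
    using preact_realisation[OF assms(1), of "[h]" l] by auto
  have "Matrix.vec 1 (\<lambda>_. h x) = Matrix.vec (length [h]) (\<lambda>i. ([h] ! i) x)" for x
    by (intro eq_vecI) auto
  with N show ?thesis
    unfolding deep_nn_def
    by (intro CollectI exI[of _ "Suc l"] exI[of _ N] exI[of _ A] exI[of _ b]) auto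
qed

text \<open>Membership is decided entry by entry, so the entries may have different depths and
  widths.\<close>

lemma relu_nets_deep_nn_time_space:
  fixes H :: "'n1::finite \<Rightarrow> 'n2::finite \<Rightarrow> real vec \<Rightarrow> real"
  assumes "\<And>i j. H i j \<in> relu_nets (CARD('k) + 1)"
  shows "(\<lambda>z :: real \<times> (real ^ 'k). \<chi> i j. H i j (input_vec z)) \<in> deep_nn_time_space relu"
proof -
  have "(\<lambda>v. \<chi> i j. H i j v) \<in> deep_nn_mat relu (CARD('k) + 1)"
    unfolding deep_nn_mat_def using relu_nets_deep_nn[OF _ assms] by simp
  then show ?thesis
    unfolding deep_nn_time_space_def by (auto simp: comp_def)
qed

section \<open>Continuity of networks\<close>

lemma input_vec_carrier: "input_vec (z :: real \<times> (real ^ 'k)) \<in> carrier_vec (CARD('k) + 1)"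
  by (cases z) (auto simp: input_vec_def)

lemma continuous_on_relu: "continuous_on S g \<Longrightarrow> continuous_on S (\<lambda>x. relu (g x))"
  unfolding relu_def by (intro continuous_intros)

lemma continuous_on_input_vec:
  assumes "i < CARD('k) + 1"
  shows "continuous_on S (\<lambda>z :: real \<times> (real ^ 'k). vec_index (input_vec z) i)"
  using assms by (cases i) (auto simp: input_vec_def case_prod_unfold intro!: continuous_intros)

text \<open>Continuity passes through the layers coordinatewise. The carrier claim is part of the
  induction, since the formula for the coordinates of a matrix-vector product needs the
  dimension.\<close>

lemma continuous_on_feed_forward:
  fixes A :: "nat \<Rightarrow> real mat" and v :: "'a::topological_space \<Rightarrow> real vec"
  assumes "\<forall>l\<in>{1..Suc L}. A l \<in> carrier_mat (N l) (N (l - 1)) \<and> b l \<in> carrier_vec (N l)"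
    and "\<And>z. v z \<in> carrier_vec (N 0)"
    and "\<And>i. i < N 0 \<Longrightarrow> continuous_on S (\<lambda>z. vec_index (v z) i)"
  shows "(\<forall>z. feed_forward relu (\<lambda>l y. A l *\<^sub>v y + b l) (Suc L) (v z) \<in> carrier_vec (N (Suc L))) \<and>
    (\<forall>i<N (Suc L). continuous_on S (\<lambda>z. vec_index (feed_forward relu (\<lambda>l y. A l *\<^sub>v y + b l) (Suc L) (v z)) i))"
  using assms(1)
proof (induction L)
  \<comment> \<open>One affine layer, used on the input in the base case and on the output of
    \<open>relu\<close> in the inductive step.\<close>
  have layer: "(\<forall>z. M *\<^sub>v y z + c \<in> carrier_vec m) \<and>
      (\<forall>i<m. continuous_on S (\<lambda>z. vec_index (M *\<^sub>v y z + c) i))"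
    if "M \<in> carrier_mat m p" "c \<in> carrier_vec m" "\<And>z. y z \<in> carrier_vec p"
      "\<And>i. i < p \<Longrightarrow> continuous_on S (\<lambda>z. vec_index (y z) i)"
    for M :: "real mat" and c y m p
  proof (intro conjI allI impI)
    fix z show "M *\<^sub>v y z + c \<in> carrier_vec m"
      using that by auto
  next
    fix i assume i: "i < m"
    have "vec_index (M *\<^sub>v y z + c) i = (\<Sum>j<p. M $$ (i, j) * vec_index (y z) j) + vec_index c i" for z
      using that(1,2) that(3)[of z] i by (simp add: scalar_prod_def lessThan_atLeast0)
    moreover have "continuous_on S (\<lambda>z. (\<Sum>j<p. M $$ (i, j) * vec_index (y z) j) + vec_index c i)"
      by (intro continuous_on_add continuous_on_sum continuous_on_mult continuous_on_const that(4)) simp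
    ultimately show "continuous_on S (\<lambda>z. vec_index (M *\<^sub>v y z + c) i)"
      by (simp only:)
  qed
  {
    case 0
    then have "A 1 \<in> carrier_mat (N (Suc 0)) (N 0)" "b 1 \<in> carrier_vec (N (Suc 0))"
      by auto
    then show ?case
      unfolding feed_forward.simps(2) by (rule layer) (fact assms(2,3))+
  next
    case (Suc L)
    let ?f = "\<lambda>z. feed_forward relu (\<lambda>l y. A l *\<^sub>v y + b l) (Suc L) (v z)"
    have "\<forall>l\<in>{1..Suc L}. A l \<in> carrier_mat (N l) (N (l - 1)) \<and> b l \<in> carrier_vec (N l)"
      using Suc.prems by auto
    from Suc.IH[OF this]
    have f: "\<And>z. ?f z \<in> carrier_vec (N (Suc L))"
      "\<And>i. i < N (Suc L) \<Longrightarrow> continuous_on S (\<lambda>z. vec_index (?f z) i)"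
      by blast+
    have A: "A (Suc (Suc L)) \<in> carrier_mat (N (Suc (Suc L))) (N (Suc L))"
      "b (Suc (Suc L)) \<in> carrier_vec (N (Suc (Suc L)))"
      using bspec[OF Suc.prems, of "Suc (Suc L)"] by simp_all
    have relu_f: "map_vec relu (?f z) \<in> carrier_vec (N (Suc L))" for z
      using f(1)[of z] by (rule map_carrier_vec[THEN iffD2])
    have "continuous_on S (\<lambda>z. vec_index (map_vec relu (?f z)) i)" if "i < N (Suc L)" for i
    proof -
      have "vec_index (map_vec relu (?f z)) i = relu (vec_index (?f z) i)" for z
        using carrier_vecD[OF f(1)[of z]] that by (intro index_map_vec(1)) (simp only:)
      then show ?thesis
        using continuous_on_relu[OF f(2)[OF that]] by (simp only:)
    qed
    with A relu_f show ?case
      unfolding feed_forward.simps(3) comp_apply by (rule layer)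
  }
qed

text \<open>Each entry of an arbitrary member is the single output coordinate of some network, to
  which \<open>continuous_on_feed_forward\<close> applies with \<open>v = input_vec\<close>.\<close>

lemma continuous_on_deep_nn_time_space:
  fixes \<phi> :: "real \<times> (real ^ 'k) \<Rightarrow> real ^ 'n2 ^ 'n1"
  assumes "\<phi> \<in> deep_nn_time_space relu"
  shows "continuous_on S \<phi>"
proof -
  obtain \<psi> :: "real vec \<Rightarrow> real ^ 'n2 ^ 'n1"
    where \<psi>: "\<psi> \<in> deep_nn_mat relu (CARD('k) + 1)" "\<phi> = \<psi> \<circ> input_vec"
    using assms unfolding deep_nn_time_space_def by blast
  have "continuous_on S (\<lambda>z. \<phi> z $ i $ j)" for i j
  proof -
    have "(\<lambda>v. Matrix.vec 1 (\<lambda>_. \<psi> v $ i $ j)) \<in> deep_nn relu (CARD('k) + 1) 1"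
      using \<psi>(1) unfolding deep_nn_mat_def by (simp only: mem_Collect_eq)
    then obtain L N A b where N: "1 \<le> L" "N 0 = CARD('k) + 1" "N L = 1"
      "\<forall>l\<in>{1..L}. A l \<in> carrier_mat (N l) (N (l - 1)) \<and> b l \<in> carrier_vec (N l)"
      "\<forall>x\<in>carrier_vec (CARD('k) + 1). Matrix.vec 1 (\<lambda>_. \<psi> x $ i $ j) =
         feed_forward relu (\<lambda>l y. A l *\<^sub>v y + b l) L x"
      unfolding deep_nn_def mem_Collect_eq by (elim exE conjE) (rule that)
    obtain L' where L': "L = Suc L'"
      using N(1) by (cases L) auto
    have carrier: "input_vec z \<in> carrier_vec (N 0)" for z :: "real \<times> (real ^ 'k)"
      using input_vec_carrier[of z] by (simp only: N(2))
    have "continuous_on S (\<lambda>z :: real \<times> (real ^ 'k). vec_index (input_vec z) i)" if "i < N 0" for i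
      using that by (intro continuous_on_input_vec) (simp add: N(2))
    then have "\<forall>i<N (Suc L'). continuous_on S (\<lambda>z :: real \<times> (real ^ 'k). vec_index
        (feed_forward relu (\<lambda>l y. A l *\<^sub>v y + b l) (Suc L') (input_vec z)) i)"
      by (intro continuous_on_feed_forward[OF N(4)[unfolded L'] carrier, THEN conjunct2])
    then have "continuous_on S (\<lambda>z :: real \<times> (real ^ 'k). vec_index
        (feed_forward relu (\<lambda>l y. A l *\<^sub>v y + b l) L (input_vec z)) 0)"
      unfolding L'[symmetric] N(3) by blast
    moreover have "vec_index (feed_forward relu (\<lambda>l y. A l *\<^sub>v y + b l) L (input_vec z)) 0 = \<phi> z $ i $ j"
      for z :: "real \<times> (real ^ 'k)"
      using bspec[OF N(5) input_vec_carrier[of z], symmetric] by (simp add: \<psi>(2))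
    ultimately show ?thesis by simp
  qed
  then have "continuous_on S (\<lambda>z. \<chi> i j. \<phi> z $ i $ j)"
    by (intro continuous_on_vec_lambda)
  then show ?thesis by simp
qed

section \<open>Density of lattices\<close>

lemma finite_max_closed:
  fixes F :: "('a \<Rightarrow> real) set"
  assumes "finite A" "A \<noteq> {}" "A \<subseteq> F"
    and "\<And>g h. g \<in> F \<Longrightarrow> h \<in> F \<Longrightarrow> (\<lambda>x. max (g x) (h x)) \<in> F"
  shows "(\<lambda>x. Max ((\<lambda>g. g x) ` A)) \<in> F"
  using assms(1-3)
proof (induction A rule: finite_ne_induct)
  case (insert g A)
  then have "(\<lambda>x. max (g x) (Max ((\<lambda>g. g x) ` A))) \<in> F"
    by (intro assms(4)) auto
  then show ?case
    using insert.hyps by simp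
qed simp

text \<open>The sets where \<open>f < g\<close> are open in \<open>S\<close> and cover it. By
  compactness finitely many suffice, and the maximum of the corresponding \<open>g\<close> dominates
  \<open>f\<close> everywhere.\<close>

lemma max_closed_dominates:
  fixes F :: "('a::topological_space \<Rightarrow> real) set"
  assumes S: "compact S" "S \<noteq> {}"
    and F: "\<And>g. g \<in> F \<Longrightarrow> continuous_on S g"
      "\<And>g h. g \<in> F \<Longrightarrow> h \<in> F \<Longrightarrow> (\<lambda>x. max (g x) (h x)) \<in> F"
    and f: "continuous_on S f" "\<And>y. y \<in> S \<Longrightarrow> \<exists>g\<in>F. f y < g y"
  shows "\<exists>g\<in>F. \<forall>y\<in>S. f y < g y"
proof -
  have "\<exists>U. open U \<and> U \<inter> S = {y\<in>S. f y < g y}" if "g \<in> F" for g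
  proof -
    have "continuous_on S (\<lambda>y. g y - f y)"
      using F(1) f(1) that by (intro continuous_intros)
    then obtain U where "open U" "U \<inter> S = (\<lambda>y. g y - f y) -` {0<..} \<inter> S"
      using continuous_on_open_invariant open_greaterThan by metis
    then show ?thesis by (intro exI[of _ U]) auto
  qed
  then obtain U where U: "\<And>g. g \<in> F \<Longrightarrow> open (U g) \<and> U g \<inter> S = {y\<in>S. f y < g y}"
    by metis
  have "S \<subseteq> (\<Union>g\<in>F. U g)"
    using f(2) U by blast
  then obtain A where A: "A \<subseteq> F" "finite A" "S \<subseteq> (\<Union>g\<in>A. U g)"
    using compactE_image[OF S(1), of F U] U by metis
  have "A \<noteq> {}"
    using A(3) S(2) by auto
  then have "(\<lambda>x. Max ((\<lambda>g. g x) ` A)) \<in> F"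
    using A F(2) by (intro finite_max_closed) auto
  moreover have "f y < Max ((\<lambda>g. g y) ` A)" if y: "y \<in> S" for y
  proof -
    obtain g where "g \<in> A" "y \<in> U g"
      using A(3) y by blast
    then have "f y < g y"
      using U A(1) y by blast
    also have "g y \<le> Max ((\<lambda>g. g y) ` A)"
      using \<open>g \<in> A\<close> A(2) by auto
    finally show ?thesis .
  qed
  ultimately show ?thesis by (intro bexI) auto
qed

text \<open>The Kakutani--Stone theorem.\<close>
lemma lattice_dense:
  fixes F :: "('a::topological_space \<Rightarrow> real) set"
  assumes S: "compact S" "S \<noteq> {}"
    and cont: "\<And>g. g \<in> F \<Longrightarrow> continuous_on S g"
    and max: "\<And>g h. g \<in> F \<Longrightarrow> h \<in> F \<Longrightarrow> (\<lambda>x. max (g x) (h x)) \<in> F"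
    and min: "\<And>g h. g \<in> F \<Longrightarrow> h \<in> F \<Longrightarrow> (\<lambda>x. min (g x) (h x)) \<in> F"
    and f: "continuous_on S f"
    and interp: "\<And>x y. x \<in> S \<Longrightarrow> y \<in> S \<Longrightarrow> \<exists>g\<in>F. g x = f x \<and> g y = f y"
    and "e > 0"
  shows "\<exists>g\<in>F. \<forall>x\<in>S. \<bar>g x - f x\<bar> < e"
proof -
  \<comment> \<open>The functions agreeing with \<open>f\<close> at \<open>x\<close> are closed
    under maxima, and the interpolant at \<open>x\<close> and \<open>y\<close> exceeds
    \<open>f - e\<close> at \<open>y\<close>.\<close>
  have lower: "\<exists>g\<in>F. g x = f x \<and> (\<forall>y\<in>S. f y - e < g y)" if x: "x \<in> S" for x
  proof -
    have "\<exists>g\<in>{g\<in>F. g x = f x}. \<forall>y\<in>S. f y - e < g y"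
    proof (rule max_closed_dominates[OF S])
      show "continuous_on S (\<lambda>y. f y - e)"
        using f by (intro continuous_intros)
      show "\<exists>g\<in>{g\<in>F. g x = f x}. f y - e < g y" if "y \<in> S" for y
        using interp[OF x that] \<open>e > 0\<close> by force
    qed (use cont max in auto)
    then show ?thesis by blast
  qed
  \<comment> \<open>Second pass with signs reversed: maxima of negatives are minima, dominating
    \<open>- f - e\<close> means staying below \<open>f + e\<close>, and minima preserve the lower
    bound \<open>f - e\<close> from the first pass.\<close>
  let ?F = "(\<lambda>g x. - g x) ` {g\<in>F. \<forall>y\<in>S. f y - e < g y}"
  have "\<exists>g\<in>?F. \<forall>y\<in>S. - f y - e < g y"
  proof (rule max_closed_dominates[OF S])
    show "continuous_on S (\<lambda>y. - f y - e)"
      using f by (intro continuous_intros)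
    show "\<exists>g\<in>?F. - f x - e < g x" if "x \<in> S" for x
      using lower[OF that] \<open>e > 0\<close> by force
    show "(\<lambda>x. max (g x) (h x)) \<in> ?F" if gh: "g \<in> ?F" "h \<in> ?F" for g h
    proof -
      obtain g' h' where *: "g = (\<lambda>x. - g' x)" "h = (\<lambda>x. - h' x)" "g' \<in> F" "h' \<in> F"
        "\<forall>y\<in>S. f y - e < g' y" "\<forall>y\<in>S. f y - e < h' y"
        using gh by blast
      have "(\<lambda>x. max (g x) (h x)) = (\<lambda>x. - min (g' x) (h' x))"
        by (auto simp: *)
      moreover have "(\<lambda>x. min (g' x) (h' x)) \<in> {g\<in>F. \<forall>y\<in>S. f y - e < g y}"
        using * min by auto
      ultimately show ?thesis by (rule image_eqI)
    qed
    show "continuous_on S g" if "g \<in> ?F" for g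
      using that cont by (auto intro!: continuous_intros)
  qed
  then obtain g where "g \<in> F" "\<forall>y\<in>S. f y - e < g y" "\<forall>y\<in>S. - f y - e < - g y"
    by blast
  then show ?thesis
    by (intro bexI[of _ g]) (auto simp: abs_less_iff algebra_simps)
qed

section \<open>Approximation under linear growth\<close>

text \<open>Networks are pulled back along \<open>input_vec\<close>, so that the lattice argument
  takes place on the inner product space \<open>real \<times> (real ^ 'k)\<close>.\<close>

definition relu_funs :: "(real \<times> (real ^ 'k) \<Rightarrow> real) set" where
  "relu_funs = (\<lambda>h z. h (input_vec z)) ` relu_nets (CARD('k) + 1)"

lemma relu_funs_scale: "g \<in> relu_funs \<Longrightarrow> (\<lambda>z. r * g z) \<in> relu_funs"
  unfolding relu_funs_def by (auto intro!: image_eqI[OF _ relu_nets_scale])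

lemma relu_funs_max: "g \<in> relu_funs \<Longrightarrow> h \<in> relu_funs \<Longrightarrow> (\<lambda>z. max (g z) (h z)) \<in> relu_funs"
  unfolding relu_funs_def by (auto intro!: image_eqI[OF _ relu_nets_max])

lemma relu_funs_min: "g \<in> relu_funs \<Longrightarrow> h \<in> relu_funs \<Longrightarrow> (\<lambda>z. min (g z) (h z)) \<in> relu_funs"
  unfolding relu_funs_def by (auto intro!: image_eqI[OF _ relu_nets_min])

lemma relu_funs_affine:
  fixes d :: "real \<times> (real ^ 'k)"
  shows "(\<lambda>z. c + inner d z) \<in> relu_funs"
proof -
  let ?e = "from_nat_into (UNIV :: 'k set)"
  have bij: "bij_betw ?e {..<CARD('k)} UNIV"
    using bij_betw_from_nat_into_finite[of "UNIV :: 'k set"] by simp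
  \<comment> \<open>Coefficient 0 belongs to time, which \<open>input_vec\<close> puts first; the
    others follow its enumeration of the space coordinates.\<close>
  define a where "a i = (case i of 0 \<Rightarrow> fst d | Suc i \<Rightarrow> snd d $ ?e i)" for i
  have "inner d z = (\<Sum>i<CARD('k) + 1. a i * vec_index (input_vec z) i)" for z
  proof -
    have "inner (snd d) (snd z) = (\<Sum>i<CARD('k). snd d $ ?e i * snd z $ ?e i)"
      using sum.reindex_bij_betw[OF bij, of "\<lambda>i. snd d $ i * snd z $ i"] by (simp add: inner_vec_def)
    then show ?thesis
      by (cases z) (simp add: inner_prod_def input_vec_def a_def sum.lessThan_Suc_shift del: sum.lessThan_Suc)
  qed
  then have "(\<lambda>z. c + inner d z) = (\<lambda>z. c + (\<Sum>i<CARD('k) + 1. a i * vec_index (input_vec z) i))"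
    by simp
  then show ?thesis
    unfolding relu_funs_def by (rule image_eqI[where x = "\<lambda>v. c + (\<Sum>i<CARD('k) + 1. a i * vec_index v i)"])
      (rule relu_nets_affine)
qed

lemma relu_funs_continuous:
  fixes g :: "real \<times> (real ^ 'k) \<Rightarrow> real"
  assumes "g \<in> relu_funs"
  shows "continuous_on S g"
proof -
  obtain h where h: "h \<in> relu_nets (CARD('k) + 1)" "g = (\<lambda>z. h (input_vec z))"
    using assms unfolding relu_funs_def by blast
  \<comment> \<open>The scalar function fills every entry of an auxiliary matrix, so continuity
    follows from the matrix case by reading off any entry; \<open>'k\<close> merely serves as a
    finite index type.\<close>
  have "(\<lambda>z. \<chi> (i :: 'k) (j :: 'k). g z) \<in> deep_nn_time_space relu"
    using relu_nets_deep_nn_time_space[of "\<lambda>_ _. h"] h by simp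
  then have "continuous_on S (\<lambda>z. (\<chi> (i :: 'k) (j :: 'k). g z) $ undefined $ undefined)"
    by (intro continuous_on_component continuous_on_deep_nn_time_space)
  then show ?thesis by simp
qed

lemma relu_funs_dense:
  fixes f :: "real \<times> (real ^ 'k) \<Rightarrow> real"
  assumes "compact S" "continuous_on S f" "e > 0"
  shows "\<exists>g\<in>relu_funs. \<forall>z\<in>S. \<bar>g z - f z\<bar> < e"
proof (cases "S = {}")
  case True
  then show ?thesis using relu_funs_affine by blast
next
  case False
  show ?thesis
  proof (rule lattice_dense[OF assms(1) False _ _ _ assms(2) _ assms(3)])
    fix x y :: "real \<times> (real ^ 'k)"
    \<comment> \<open>Slope of the affine interpolant in the direction \<open>y - x\<close>. If
      \<open>x = y\<close>, then \<open>r = 0\<close> and the interpolant is the constant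
      \<open>f x\<close>.\<close>
    define r where "r = (f y - f x) / inner (y - x) (y - x)"
    have "(\<lambda>z. (f x - inner (r *\<^sub>R (y - x)) x) + inner (r *\<^sub>R (y - x)) z) \<in> relu_funs"
      by (rule relu_funs_affine)
    moreover have "r * inner (y - x) (y - x) = f y - f x"
      by (simp add: r_def)
    ultimately show "\<exists>g\<in>relu_funs. g x = f x \<and> g y = f y"
      by (intro bexI) (auto simp: algebra_simps)
  qed (auto intro: relu_funs_continuous relu_funs_max relu_funs_min)
qed

text \<open>Since \<open>norm x\<close> is the supremum of the linear forms \<open>inner y x\<close> with \<open>norm y \<le> 1\<close>, finitely
  many of them approximate it from below on bounded sets.\<close>
lemma relu_funs_norm_below:
  assumes "bounded K" "e > 0"
  shows "\<exists>g\<in>relu_funs. (\<forall>t x. g (t, x) \<le> 1 + norm (x :: real ^ 'k)) \<and>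
    (\<forall>t. \<forall>x\<in>K. 1 + norm x - e \<le> g (t, x))"
proof -
  obtain R where R: "R > 0" "\<And>x. x \<in> K \<Longrightarrow> norm x \<le> R"
    using assms(1) bounded_pos by blast
  \<comment> \<open>A finite net of mesh \<open>e / R\<close> is extracted: an error in direction is
    multiplied by \<open>norm x\<close>, at most \<open>R\<close> on \<open>K\<close>.\<close>
  have "cball 0 1 \<subseteq> (\<Union>y\<in>cball 0 1. ball (y :: real ^ 'k) (e / R))"
    using assms(2) R(1) by force
  then obtain Y :: "(real ^ 'k) set" where Y: "Y \<subseteq> cball 0 1" "finite Y" "cball 0 1 \<subseteq> (\<Union>y\<in>Y. ball y (e / R))"
    using compactE_image[OF compact_cball, of "cball 0 1" "\<lambda>y. ball y (e / R)" 0 1] by (metis open_ball)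
  have "Y \<noteq> {}"
    using Y(3) by force
  let ?A = "(\<lambda>y z. 1 + inner y (snd z)) ` Y"
  let ?g = "\<lambda>z :: real \<times> (real ^ 'k). Max ((\<lambda>g. g z) ` ?A)"
  have "(\<lambda>z. 1 + inner y (snd z)) \<in> relu_funs" for y :: "real ^ 'k"
    using relu_funs_affine[of 1 "(0, y)"] by (simp add: inner_prod_def)
  then have "?g \<in> relu_funs"
    using Y(2) \<open>Y \<noteq> {}\<close> by (intro finite_max_closed) (auto intro: relu_funs_max)
  have le: "?g (t, x) \<le> 1 + norm x" for t x
  proof -
    have "inner y x \<le> norm x" if "y \<in> Y" for y
      using norm_cauchy_schwarz[of y x] Y(1) that mult_right_mono[of "norm y" 1 "norm x"] by fastforce
    then show ?thesis
      using Y(2) \<open>Y \<noteq> {}\<close> by simp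
  qed
  have ge: "1 + norm x - e \<le> ?g (t, x)" if "x \<in> K" for t x
  proof -
    \<comment> \<open>\<open>sgn x\<close> is the direction of \<open>x\<close>, and 0 at 0, so
      \<open>inner (sgn x) x = norm x\<close> in every case.\<close>
    have "sgn x \<in> cball 0 1"
      by (simp add: norm_sgn)
    then obtain y where y: "y \<in> Y" "norm (sgn x - y) < e / R"
      using Y(3) by (force simp: dist_norm norm_minus_commute)
    have "norm x - inner y x = inner (sgn x - y) x"
      by (cases "x = 0") (auto simp: sgn_div_norm inner_diff_left dot_square_norm power2_eq_square)
    also have "\<dots> \<le> norm (sgn x - y) * norm x"
      by (rule norm_cauchy_schwarz)
    also have "\<dots> \<le> e / R * R"
      using y(2) R that assms(2) by (intro mult_mono) auto
    also have "\<dots> = e"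
      using R(1) by simp
    finally have "1 + norm x - e \<le> 1 + inner y x"
      by simp
    also have "\<dots> \<le> ?g (t, x)"
      using y(1) Y(2) unfolding image_image by (intro Max_ge) auto
    finally show ?thesis .
  qed
  show ?thesis
  proof (intro bexI[of _ ?g] conjI allI ballI)
    show "?g \<in> relu_funs" by fact
  qed (rule le, rule ge)
qed

text \<open>Enlarging \<open>C\<close> to \<open>1 + C\<close> leaves a slack of
  \<open>1 + norm x\<close>, hence at least 1, which absorbs the error of approximating the norm on
  \<open>K\<close>.\<close>

lemma relu_funs_approx_growth:
  fixes f :: "real \<times> (real ^ 'k) \<Rightarrow> real"
  assumes f: "continuous_on ({0..T} \<times> UNIV) f" "C > 0" "linear_growth T C f"
    and K: "compact K" and "e > 0"
  shows "\<exists>g\<in>relu_funs. (\<forall>z\<in>{0..T} \<times> K. \<bar>g z - f z\<bar> < e) \<and> linear_growth T (1 + C) g"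
proof -
  have "continuous_on ({0..T} \<times> K) f"
    using f(1) by (rule continuous_on_subset) auto
  then obtain h where h: "h \<in> relu_funs" "\<And>z. z \<in> {0..T} \<times> K \<Longrightarrow> \<bar>h z - f z\<bar> < e"
    using relu_funs_dense[OF compact_Times[OF compact_Icc K]] \<open>e > 0\<close> by blast
  \<comment> \<open>The error \<open>1 / (1 + C)\<close> becomes exactly 1 after scaling by
    \<open>1 + C\<close>.\<close>
  obtain p where p: "p \<in> relu_funs" "\<And>t x. p (t, x) \<le> 1 + norm x"
    "\<And>t x. x \<in> K \<Longrightarrow> 1 + norm x - 1 / (1 + C) \<le> p (t, x)"
    using relu_funs_norm_below[OF compact_imp_bounded[OF K], of "1 / (1 + C)"] \<open>C > 0\<close> by force
  \<comment> \<open>Nothing bounds \<open>p\<close> from below off \<open>K\<close>; the maximum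
    with 0 keeps the clipping interval from \<open>- u\<close> to \<open>u\<close> nonempty
    everywhere.\<close>
  define u where "u z = (1 + C) * max 0 (p z)" for z
  have "(\<lambda>_. 0) \<in> relu_funs"
    using relu_funs_affine[of 0 0] by simp
  then have "u \<in> relu_funs"
    unfolding u_def using p(1) by (intro relu_funs_scale relu_funs_max)
  have u_nonneg: "0 \<le> u z" for z
    using f(2) by (simp add: u_def)
  have u_le: "u (t, x) \<le> (1 + C) * (1 + norm x)" for t x
    unfolding u_def using p(2)[of t x] f(2) by (intro mult_left_mono) auto
  \<comment> \<open>Hence clipping at \<open>u\<close> does not increase the error on \<open>K\<close>.\<close>
  have f_le: "\<bar>f (t, x)\<bar> \<le> u (t, x)" if "t \<in> {0..T}" "x \<in> K" for t x
  proof -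
    have "\<bar>f (t, x)\<bar> \<le> C * (1 + norm x)"
      using f(3) that unfolding linear_growth_def by fastforce
    also have "\<dots> \<le> (1 + C) * (1 + norm x) - 1"
      by (simp add: algebra_simps)
    also have "\<dots> = (1 + C) * (1 + norm x - 1 / (1 + C))"
      using f(2) by (simp add: right_diff_distrib)
    also have "\<dots> \<le> u (t, x)"
      unfolding u_def using p(3)[OF that(2), of t] f(2) by (intro mult_left_mono) auto
    finally show ?thesis .
  qed
  let ?g = "\<lambda>z. max (- 1 * u z) (min (h z) (u z))"
  have "?g \<in> relu_funs"
    using h(1) \<open>u \<in> relu_funs\<close> by (intro relu_funs_max relu_funs_min relu_funs_scale)
  moreover have "\<bar>?g z - f z\<bar> < e" if z: "z \<in> {0..T} \<times> K" for z
  proof -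
    have "\<bar>f z\<bar> \<le> u z"
      using z f_le by auto
    with h(2)[OF z] show ?thesis by linarith
  qed
  moreover have "\<bar>?g (t, x)\<bar> \<le> (1 + C) * (1 + norm x)" for t x
    using u_nonneg[of "(t, x)"] u_le[of t x] by linarith
  ultimately show ?thesis
    unfolding linear_growth_def by (intro bexI[of _ ?g]) auto
qed

section \<open>Passage from scalar entries to matrices\<close>

lemma norm_vec_le_sqrt_card:
  fixes v :: "'a::real_normed_vector ^ 'n"
  assumes "\<And>i. norm (v $ i) \<le> M"
  shows "norm v \<le> sqrt (CARD('n)) * M"
proof -
  have "0 \<le> M"
    using assms order_trans[OF norm_ge_zero] by blast
  have "(\<Sum>i\<in>UNIV. (norm (v $ i))\<^sup>2) \<le> (\<Sum>i\<in>(UNIV :: 'n set). M\<^sup>2)"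
    using assms by (intro sum_mono power_mono) auto
  then have "norm v \<le> sqrt (real CARD('n) * M\<^sup>2)"
    by (simp add: norm_vec_def L2_set_def)
  also have "\<dots> = sqrt (CARD('n)) * M"
    using \<open>0 \<le> M\<close> by (simp add: real_sqrt_mult)
  finally show ?thesis .
qed

text \<open>The vector bound is applied to each row and then to the vector of rows. This is the
  source of the factor \<surd>(n1 n2).\<close>

lemma norm_matrix_le_sqrt_card:
  fixes X :: "real ^ 'n2 ^ 'n1"
  assumes "\<And>i j. \<bar>X $ i $ j\<bar> \<le> M"
  shows "norm X \<le> sqrt (real (CARD('n1) * CARD('n2))) * M"
proof -
  have "norm (X $ i) \<le> sqrt (CARD('n2)) * M" for i
    using assms by (intro norm_vec_le_sqrt_card) simp
  then have "norm X \<le> sqrt (CARD('n1)) * (sqrt (CARD('n2)) * M)"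
    by (rule norm_vec_le_sqrt_card)
  then show ?thesis
    by (simp add: real_sqrt_mult mult.assoc)
qed

text \<open>Each entry of \<open>f\<close> inherits the growth constant \<open>C\<close> and is
  approximated separately within \<open>\<epsilon> / ?s\<close>. Passing to the matrix norm costs
  the factor \<open>?s\<close> in both the error and the growth bound.\<close>

lemma deep_nn_approximable_with_growth:
  fixes f :: "real \<times> (real ^ 'k) \<Rightarrow> real ^ 'n2 ^ 'n1"
  assumes f: "continuous_on ({0..T} \<times> UNIV) f" "C > 0" "linear_growth T C f"
  shows "approximable_with_growth T (deep_nn_time_space relu) f
    (sqrt (real (CARD('n1) * CARD('n2))) * (1 + C))"
  unfolding approximable_with_growth_def
proof (intro ballI allI impI)
  fix \<epsilon> :: real and K :: "(real ^ 'k) set"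
  assume \<epsilon>: "\<epsilon> \<in> {0<..<1}" and K: "compact K"
  let ?s = "sqrt (real (CARD('n1) * CARD('n2)))"
  have s: "?s > 0"
    by simp
  have entry_le: "\<bar>X $ i $ j\<bar> \<le> norm X" for X :: "real ^ 'n2 ^ 'n1" and i j
    using Finite_Cartesian_Product.norm_nth_le[of X i] Finite_Cartesian_Product.norm_nth_le[of "X $ i" j] by simp
  have "\<exists>g\<in>relu_funs. (\<forall>z\<in>{0..T} \<times> K. \<bar>g z - f z $ i $ j\<bar> < \<epsilon> / ?s) \<and> linear_growth T (1 + C) g" for i j
  proof (rule relu_funs_approx_growth[OF _ f(2) _ K])
    show "continuous_on ({0..T} \<times> UNIV) (\<lambda>z. f z $ i $ j)"
      using f(1) by (intro continuous_on_component)
    show "linear_growth T C (\<lambda>z. f z $ i $ j)"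
      using f(3) unfolding linear_growth_def real_norm_def by (blast intro: order_trans entry_le)
    show "\<epsilon> / ?s > 0"
      using \<epsilon> s by simp
  qed
  then have "\<exists>h\<in>relu_nets (CARD('k) + 1). (\<forall>z\<in>{0..T} \<times> K. \<bar>h (input_vec z) - f z $ i $ j\<bar> < \<epsilon> / ?s) \<and>
      linear_growth T (1 + C) (\<lambda>z :: real \<times> (real ^ 'k). h (input_vec z))" for i j
    unfolding relu_funs_def by blast
  then obtain H where H: "\<And>i j. H i j \<in> relu_nets (CARD('k) + 1)"
    "\<And>i j z. z \<in> {0..T} \<times> K \<Longrightarrow> \<bar>H i j (input_vec z) - f z $ i $ j\<bar> < \<epsilon> / ?s"
    "\<And>i j. linear_growth T (1 + C) (\<lambda>z :: real \<times> (real ^ 'k). H i j (input_vec z))"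
    by metis
  let ?\<phi> = "\<lambda>z :: real \<times> (real ^ 'k). \<chi> i j. H i j (input_vec z)"
  show "\<exists>\<phi>\<in>deep_nn_time_space relu. sup_norm ({0..T} \<times> K) (\<lambda>z. \<phi> z - f z) \<le> ennreal \<epsilon> \<and>
      linear_growth T (?s * (1 + C)) \<phi>"
  proof (intro bexI[of _ ?\<phi>] conjI)
    show "?\<phi> \<in> deep_nn_time_space relu"
      using H(1) by (rule relu_nets_deep_nn_time_space)
    have "norm (?\<phi> z - f z) \<le> \<epsilon>" if "z \<in> {0..T} \<times> K" for z
    proof -
      have "norm (?\<phi> z - f z) \<le> ?s * (\<epsilon> / ?s)"
        using H(2)[OF that] by (intro norm_matrix_le_sqrt_card) (simp add: less_imp_le)
      with s show ?thesis by simp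
    qed
    then show "sup_norm ({0..T} \<times> K) (\<lambda>z. ?\<phi> z - f z) \<le> ennreal \<epsilon>"
      unfolding sup_norm_def by (intro SUP_least ennreal_leI)
    have "norm (?\<phi> (t, x)) \<le> ?s * ((1 + C) * (1 + norm x))" if "t \<in> {0..T}" for t x
      using H(3) that unfolding linear_growth_def by (intro norm_matrix_le_sqrt_card) simp
    then show "linear_growth T (?s * (1 + C)) ?\<phi>"
      unfolding linear_growth_def by (simp add: mult.assoc)
  qed
qed

theorem proposition2p9:
  fixes T :: real
  assumes "T > 0"
  shows "universal_approximation_linear_growth T
           (deep_nn_time_space relu :: (real \<times> (real ^ 'k) \<Rightarrow> real ^ 'n2 ^ 'n1) set) \<and>
         (\<forall>(f :: real \<times> (real ^ 'k) \<Rightarrow> real ^ 'n2 ^ 'n1) C.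
           continuous_on ({0..T} \<times> UNIV) f \<longrightarrow> C > 0 \<longrightarrow> linear_growth T C f \<longrightarrow>
           approximable_with_growth T (deep_nn_time_space relu) f
             (sqrt (real (CARD('n1) * CARD('n2))) * (1 + C)))"
proof (intro conjI allI impI)
  \<comment> \<open>The explicit constant serves as witness; it depends on \<open>f\<close> only
    through \<open>C\<close> and is positive because \<open>C > 0\<close>.\<close>
  have "\<exists>C'>0. approximable_with_growth T (deep_nn_time_space relu) f C'"
    if "continuous_on ({0..T} \<times> UNIV) f" "C > 0" "linear_growth T C f"
    for f :: "real \<times> (real ^ 'k) \<Rightarrow> real ^ 'n2 ^ 'n1" and C
    using deep_nn_approximable_with_growth[OF that] that(2)
    by (intro exI[of _ "sqrt (real (CARD('n1) * CARD('n2))) * (1 + C)"]) simp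
  then show "universal_approximation_linear_growth T
      (deep_nn_time_space relu :: (real \<times> (real ^ 'k) \<Rightarrow> real ^ 'n2 ^ 'n1) set)"
    unfolding universal_approximation_linear_growth_def
    using continuous_on_deep_nn_time_space by blast
qed (rule deep_nn_approximable_with_growth)

end
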